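(* Let $X$ be a finite-dimensional complex Banach space and let $\phi\in\mathcal{H}L_0(B_X,X)$ with $\phi(B_X)\subseteq B_X$. Then the following assertions are equivalent. (1) There exists $n\in\mathbb N$ such that $\|\phi^{(n)}\|_\infty<1$. (2) $\lim_{n\to\infty}\|\phi^{(n)}\|_\infty=0$. (3) $\lim_{n\to\infty}\|\phi^{(n)}(x)\|=0$ for all $x\in\overline{B}_X$. (4) $\phi(C)\not\subseteq C$ for all $\emptyset\neq C\subseteq S_X$. (5) $\operatorname{Orb}_\phi(x)\not\subseteq S_X$ for all $x\in S_X$.
   Context: $B_X$, $\overline{B}_X$ and $S_X$ denote the open unit ball, closed unit ball and unit sphere of $X$. $\mathcal{H}L_0(B_X,X)$ is the space of all holomorphic Lipschitz maps $f\colon B_X\to X$ with $f(0)=0$. Such a map $\phi$ is identified with its unique Lipschitz extension to $\overline{B}_X$; when $\phi(B_X)\subseteq B_X$ this extension maps $\overline{B}_X$ into $\overline{B}_X$. $\phi^{(n)}=\phi\circ\cdots\circ\phi$ is the $n$-fold composition ($n\geq1$), $\|\phi^{(n)}\|_\infty=\sup_{x\in B_X}\|\phi^{(n)}(x)\|$, and for $x\in\overline{B}_X$ the orbit of $x$ is $\operatorname{Orb}_\phi(x)=\{x\}\cup\{\phi^{(n)}(x):n\in\mathbb N\}\subseteq\overline{B}_X$. *)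

theory Defs
  imports "HOL-Analysis.Analysis"
begin

class complex_normed_vector = real_normed_vector +
  fixes scaleC :: "complex \<Rightarrow> 'a \<Rightarrow> 'a"  (infixr \<open>*\<^sub>C\<close> 75)
  assumes scaleC_add_right: "a *\<^sub>C (x + y) = a *\<^sub>C x + a *\<^sub>C y"
    and scaleC_add_left: "(a + b) *\<^sub>C x = a *\<^sub>C x + b *\<^sub>C x"
    and scaleC_scaleC: "a *\<^sub>C (b *\<^sub>C x) = (a * b) *\<^sub>C x"
    and scaleC_one: "1 *\<^sub>C x = x"
    and scaleC_of_real: "complex_of_real r *\<^sub>C x = r *\<^sub>R x"
    and norm_scaleC: "norm (a *\<^sub>C x) = cmod a * norm x"

class complex_banach = complex_normed_vector + banach

instantiation complex :: complex_banach
begin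

definition scaleC_complex :: "complex \<Rightarrow> complex \<Rightarrow> complex"
  where "scaleC_complex = (*)"

instance
  by standard (simp_all add: scaleC_complex_def algebra_simps norm_mult scaleR_conv_of_real)

end

lemma vector_space_scaleC:
  "vector_space (scaleC :: complex \<Rightarrow> 'a \<Rightarrow> 'a::complex_normed_vector)"
  by unfold_locales (simp_all add: scaleC_add_right scaleC_add_left scaleC_scaleC scaleC_one)

text \<open>
  Holomorphy on an open set is Frechet differentiability with a complex-linear derivative;
  boundedness and additivity of \<open>D\<close> are part of \<^const>\<open>has_derivative\<close>.
\<close>

definition holomorphic_map_on ::
    "('a::complex_normed_vector \<Rightarrow> 'b::complex_normed_vector) \<Rightarrow> 'a set \<Rightarrow> bool"
  where "holomorphic_map_on f U \<longleftrightarrow>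
    (\<forall>x\<in>U. \<exists>D. (f has_derivative D) (at x) \<and> (\<forall>c v. D (c *\<^sub>C v) = c *\<^sub>C D v))"

text \<open>Maps on the open unit ball are total functions; their values off the ball play no role.\<close>

definition HL0 :: "('a::complex_normed_vector \<Rightarrow> 'b::complex_normed_vector) set"
  where "HL0 = {f. holomorphic_map_on f (ball 0 1) \<and> (\<exists>L. L-lipschitz_on (ball 0 1) f) \<and> f 0 = 0}"

text \<open>
  The unique Lipschitz extension to the closed unit ball. The set \<^const>\<open>extensional\<close> fixes
  the irrelevant values off the closed ball, so that the description is unique.
\<close>

definition lipschitz_extension ::
    "('a::real_normed_vector \<Rightarrow> 'b::real_normed_vector) \<Rightarrow> 'a \<Rightarrow> 'b"
  where "lipschitz_extension f =
    (THE g. g \<in> extensional (cball 0 1) \<and> (\<exists>L. L-lipschitz_on (cball 0 1) g)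
          \<and> (\<forall>x\<in>ball 0 1. g x = f x))"

lemma lipschitz_extension_ex1:
  fixes f :: "'a::real_normed_vector \<Rightarrow> 'b::banach"
  assumes "L-lipschitz_on (ball 0 1) f"
  shows "\<exists>!g. g \<in> extensional (cball 0 1) \<and> (\<exists>L. L-lipschitz_on (cball 0 1) g)
            \<and> (\<forall>x\<in>ball 0 1. g x = f x)"
proof (rule ex_ex1I)
  have cl: "closure (ball (0::'a) 1) = cball 0 1"
    by simp
  obtain g where g: "L-lipschitz_on (cball 0 1) g" "\<forall>x\<in>ball 0 1. g x = f x"
    using lipschitz_extend_closure[OF assms] unfolding cl by blast
  have "L-lipschitz_on (cball 0 1) (restrict g (cball 0 1))"
    by (rule lipschitz_on_transform[OF g(1)]) auto
  then show "\<exists>g. g \<in> extensional (cball 0 1) \<and> (\<exists>L. L-lipschitz_on (cball 0 1) g)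
            \<and> (\<forall>x\<in>ball 0 1. g x = f x)"
    using g(2) by (intro exI[of _ "restrict g (cball 0 1)"]) auto
next
  fix g h :: "'a \<Rightarrow> 'b"
  assume g: "g \<in> extensional (cball 0 1) \<and> (\<exists>L. L-lipschitz_on (cball 0 1) g)
            \<and> (\<forall>x\<in>ball 0 1. g x = f x)"
    and h: "h \<in> extensional (cball 0 1) \<and> (\<exists>L. L-lipschitz_on (cball 0 1) h)
            \<and> (\<forall>x\<in>ball 0 1. h x = f x)"
  have cl: "closure (ball (0::'a) 1) = cball 0 1"
    by simp
  have "continuous_on (cball 0 1) g" "continuous_on (cball 0 1) h"
    using g h lipschitz_on_continuous_on by blast+
  then have "continuous_on (closure (ball 0 1)) (\<lambda>x. g x - h x)"
    unfolding cl by (intro continuous_intros)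
  then have "g x - h x = 0" if "x \<in> cball 0 1" for x
    by (rule continuous_constant_on_closure) (use g h that cl in auto)
  then show "g = h"
    using g h by (intro extensionalityI[of g "cball 0 1" h]) auto
qed

definition unif_norm :: "('a::real_normed_vector \<Rightarrow> 'b::real_normed_vector) \<Rightarrow> real"
  where "unif_norm f = (SUP x\<in>ball 0 1. norm (f x))"

definition orbit_of :: "('a::real_normed_vector \<Rightarrow> 'a) \<Rightarrow> 'a \<Rightarrow> 'a set"
  where "orbit_of \<phi> x = {x} \<union> {(lipschitz_extension \<phi> ^^ n) x | n. n \<ge> 1}"

end

theory Submission
  imports Defs "HOL-Complex_Analysis.Conformal_Mappings"
begin

text \<open>
  Write \<open>\<Phi>\<close> for the extension of \<open>\<phi>\<close> to the closed ball. The assertions are linked in a circle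
  from the first to the last and back. Three of the links are soft: the norm of an iterate of
  \<open>\<Phi>\<close> at a boundary point is bounded by the supremum over the open ball, because that ball is
  dense; an invariant subset of the sphere contains an orbit that never comes closer to the
  origin; and an orbit that stays in the sphere is itself an invariant subset.

  From the orbit condition back to an iterate of norm less than one the reason is compactness.
  Since \<open>\<Phi>\<close> maps the open ball into itself, a point that has left the sphere never returns.
  The closed sets of points whose first \<open>n\<close> iterates all lie on the sphere therefore decrease,
  and a point common to all of them would have its whole orbit in the sphere. In the
  compact closed ball one of these sets is then empty
  (\<open>funpow_norm_less_one_uniform\<close>). Compactness of the ball comes from a
  finite spanning set (\<open>compact_span_Int_cball\<close>).

  From one iterate \<open>\<psi>\<close> of supremum norm \<open>r < 1\<close> to convergence the reason is the Schwarz lemma: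
  as \<open>\<psi>\<close> fixes the origin, \<open>norm (\<psi> x) \<le> r * norm x\<close>, so the powers of \<open>\<psi>\<close> shrink
  geometrically, and the remaining iterates lie between these powers. For maps between normed
  spaces the Schwarz lemma follows from the one for the disc, applied along a complex line and
  after composition with a linear functional of norm at most one that attains the norm at the
  given value. Such a functional is supplied by the Hahn-Banach theorem
  (\<open>complex_norming_functional\<close>).
\<close>

section \<open>Norming functionals\<close>

text \<open>
  The inequality for positive factors is all that has to be checked when an infimum of functions
  is formed; equality, and the value zero at the origin, follow from it.
\<close>

definition sublinear :: "('a::real_vector \<Rightarrow> real) \<Rightarrow> bool"
  where "sublinear p \<longleftrightarrow>
    (\<forall>x y. p (x + y) \<le> p x + p y) \<and> (\<forall>c>0. \<forall>x. p (c *\<^sub>R x) \<le> c * p x)"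

lemma sublinear_add: "sublinear p \<Longrightarrow> p (x + y) \<le> p x + p y"
  by (simp add: sublinear_def)

lemma sublinear_scaleR_pos:
  assumes "sublinear p" "c > 0"
  shows "p (c *\<^sub>R x) = c * p x"
proof (rule antisym)
  show "p (c *\<^sub>R x) \<le> c * p x"
    using assms by (simp add: sublinear_def)
  have "p (inverse c *\<^sub>R (c *\<^sub>R x)) \<le> inverse c * p (c *\<^sub>R x)"
    using assms unfolding sublinear_def by (meson positive_imp_inverse_positive)
  then show "c * p x \<le> p (c *\<^sub>R x)"
    using assms(2) by (simp add: field_simps)
qed

lemma sublinear_zero: "sublinear p \<Longrightarrow> p 0 = 0"
  using sublinear_scaleR_pos[of p 2 0] by simp

lemma sublinear_scaleR:
  assumes "sublinear p" "c \<ge> 0"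
  shows "p (c *\<^sub>R x) = c * p x"
  using assms sublinear_scaleR_pos[of p c x] sublinear_zero[of p] by (cases "c = 0") auto

lemma sublinear_neg_le: "sublinear p \<Longrightarrow> - p (- x) \<le> p x"
  using sublinear_add[of p x "- x"] sublinear_zero[of p] by simp

text \<open>
  The functions \<open>h i\<close> need not be sublinear one by one: it suffices that the family as a
  whole absorbs sums and positive factors. Both uses below have this form, once for the shifts
  of a sublinear function in a fixed direction and once for a chain of sublinear functions.
\<close>

lemma sublinear_INF:
  fixes h :: "'i \<Rightarrow> 'a::real_vector \<Rightarrow> real"
  assumes ne: "I \<noteq> {}"
    and bdd: "\<And>x. bdd_below ((\<lambda>i. h i x) ` I)"
    and add: "\<And>i j x y. i \<in> I \<Longrightarrow> j \<in> I \<Longrightarrow> \<exists>k\<in>I. h k (x + y) \<le> h i x + h j y"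
    and scale: "\<And>i c x. i \<in> I \<Longrightarrow> c > 0 \<Longrightarrow> \<exists>k\<in>I. h k (c *\<^sub>R x) \<le> c * h i x"
  shows "sublinear (\<lambda>x. INF i\<in>I. h i x)"
  unfolding sublinear_def
proof (intro conjI allI impI)
  let ?u = "\<lambda>x. INF i\<in>I. h i x"
  have le: "?u x \<le> h k x" if "k \<in> I" for k x
    by (rule cINF_lower[OF bdd that])
  fix x y :: 'a
  have *: "?u (x + y) \<le> h i x + h j y" if "i \<in> I" "j \<in> I" for i j
    using add[OF that, of x y] le order_trans by blast
  have "?u (x + y) - h i x \<le> ?u y" if "i \<in> I" for i
    by (rule cINF_greatest[OF ne]) (use *[OF that] in \<open>simp add: algebra_simps\<close>)
  then have "?u (x + y) - ?u y \<le> ?u x"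
    by (intro cINF_greatest[OF ne]) (simp add: algebra_simps)
  then show "?u (x + y) \<le> ?u x + ?u y"
    by simp
next
  let ?u = "\<lambda>x. INF i\<in>I. h i x"
  fix c :: real and x :: 'a
  assume c: "c > 0"
  have "?u (c *\<^sub>R x) \<le> c * h i x" if "i \<in> I" for i
    using scale[OF that c, of x] cINF_lower[OF bdd] order_trans by blast
  then have "?u (c *\<^sub>R x) / c \<le> ?u x"
    by (intro cINF_greatest[OF ne]) (use c in \<open>simp add: field_simps\<close>)
  then show "?u (c *\<^sub>R x) \<le> c * ?u x"
    using c by (simp add: field_simps)
qed

text \<open>
  Every sublinear function can be lowered so far that it becomes additive in the direction
  \<open>y\<close>: take the infimum of \<open>p (x + t *\<^sub>R y) - t * p y\<close> over \<open>t \<ge> 0\<close>. The values at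
  \<open>t = 0\<close> and \<open>t = 1\<close> give the two bounds. This one construction serves twice: it shows that
  minimal sublinear functions are additive, and it prescribes the value of the functional at a
  given vector.
\<close>

lemma sublinear_straighten:
  assumes p: "sublinear p"
  obtains q where "sublinear q" "\<And>x. q x \<le> p x" "\<And>x. q x \<le> p (x + y) - p y"
proof -
  define h where "h t x = p (x + t *\<^sub>R y) - t * p y" for t x
  have "- p (- x) \<le> h t x" if "t \<ge> 0" for t x
    using sublinear_add[OF p, of "- x" "x + t *\<^sub>R y"] sublinear_scaleR[OF p that, of y]
    by (simp add: h_def)
  then have bdd: "bdd_below ((\<lambda>t. h t x) ` {0..})" for x
    by (auto intro!: bdd_belowI)
  have "sublinear (\<lambda>x. INF t\<in>{0..}. h t x)"
  proof (rule sublinear_INF[OF _ bdd])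
    fix s t :: real and x z :: 'a
    assume "s \<in> {0..}" "t \<in> {0..}"
    then show "\<exists>k\<in>{0..}. h k (x + z) \<le> h s x + h t z"
      using sublinear_add[OF p, of "x + s *\<^sub>R y" "z + t *\<^sub>R y"]
      by (intro bexI[of _ "s + t"]) (simp_all add: h_def algebra_simps)
  next
    fix t c :: real and x :: 'a
    assume "t \<in> {0..}" "c > 0"
    then show "\<exists>k\<in>{0..}. h k (c *\<^sub>R x) \<le> c * h t x"
      using sublinear_scaleR_pos[OF p, of c "x + t *\<^sub>R y"]
      by (intro bexI[of _ "c * t"]) (simp_all add: h_def algebra_simps)
  qed simp
  moreover have "(INF t\<in>{0..}. h t x) \<le> p x" for x
    using cINF_lower[OF bdd, of 0 x] by (simp add: h_def)
  moreover have "(INF t\<in>{0..}. h t x) \<le> p (x + y) - p y" for x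
    using cINF_lower[OF bdd, of 1 x] by (simp add: h_def)
  ultimately show thesis
    by (rule that)
qed

text \<open>
  The Hahn-Banach theorem. By Zorn's lemma there is a minimal sublinear function below \<open>p\<close>, and
  straightening it in an arbitrary direction changes nothing, so it is linear.
\<close>

lemma linear_below_sublinear:
  fixes p :: "'a::real_vector \<Rightarrow> real"
  assumes p: "sublinear p"
  obtains l where "linear l" "\<And>x. l x \<le> p x"
proof -
  define A where "A = {q. sublinear q \<and> q \<le> p}"
  have "\<exists>m\<in>A. \<forall>a\<in>A. m \<ge> a \<longrightarrow> a = m"
  proof (rule predicate_Zorn)
    show "partial_order_on A (relation_of (\<ge>) A)"
      by (rule partial_order_on_relation_ofI) auto
  next
    fix C
    assume C: "C \<in> Chains (relation_of (\<ge>) A)"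
    then have CA: "C \<subseteq> A"
      by (rule Chains_relation_of)
    have chain: "q \<le> r \<or> r \<le> q" if "q \<in> C" "r \<in> C" for q r
      using C that by (auto simp: Chains_def relation_of_def)
    show "\<exists>u\<in>A. \<forall>a\<in>C. a \<ge> u"
    proof (cases "C = {}")
      case True
      then show ?thesis using p by (auto simp: A_def)
    next
      case False
      let ?u = "\<lambda>x. INF q\<in>C. q x"
      have "- p (- x) \<le> q x" if "q \<in> C" for q x
      proof -
        have "sublinear q" "q (- x) \<le> p (- x)"
          using that CA by (auto simp: A_def le_fun_def)
        then show ?thesis using sublinear_neg_le[of q x] by linarith
      qed
      then have bdd: "bdd_below ((\<lambda>q. q x) ` C)" for x
        by (auto intro!: bdd_belowI)
      have lower: "?u x \<le> q x" if "q \<in> C" for q x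
        by (rule cINF_lower[OF bdd that])
      have "sublinear ?u"
      proof (rule sublinear_INF[OF False bdd])
        fix q r x y
        assume qr: "q \<in> C" "r \<in> C"
        then have "sublinear q" "sublinear r"
          using CA by (auto simp: A_def)
        then have "q (x + y) \<le> q x + q y" "r (x + y) \<le> r x + r y"
          by (simp_all add: sublinear_add)
        moreover have "q y \<le> r y \<or> r x \<le> q x"
          using chain[OF qr] by (auto simp: le_fun_def)
        ultimately have "q (x + y) \<le> q x + r y \<or> r (x + y) \<le> q x + r y"
          by linarith
        then show "\<exists>k\<in>C. k (x + y) \<le> q x + r y"
          using qr by blast
      next
        fix q c x
        assume "q \<in> C" "(c::real) > 0"
        then show "\<exists>k\<in>C. k (c *\<^sub>R x) \<le> c * q x"
          using CA by (auto simp: A_def sublinear_def)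
      qed
      moreover have "?u \<le> p"
      proof (rule le_funI)
        fix x
        obtain q where "q \<in> C"
          using False by blast
        then have "?u x \<le> q x" "q x \<le> p x"
          using lower CA by (auto simp: A_def le_fun_def)
        then show "?u x \<le> p x"
          by (rule order_trans)
      qed
      ultimately have "?u \<in> A"
        by (simp add: A_def)
      moreover have "\<forall>q\<in>C. ?u \<le> q"
        using lower by (intro ballI le_funI)
      ultimately show ?thesis
        by blast
    qed
  qed
  then obtain m where mA: "m \<in> A" and minA: "\<And>q. q \<in> A \<Longrightarrow> q \<le> m \<Longrightarrow> q = m"
    by blast
  from mA have m: "sublinear m" "m \<le> p"
    by (simp_all add: A_def)
  have min: "q = m" if "sublinear q" "q \<le> m" for q
    using that order_trans[OF that(2) m(2)] by (intro minA) (simp_all add: A_def)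
  \<comment> \<open>Straightening \<open>m\<close> in the direction \<open>y\<close> returns \<open>m\<close>; this is superadditivity.\<close>
  have add: "m (x + y) = m x + m y" for x y
  proof -
    obtain q where "sublinear q" "\<And>x. q x \<le> m x" and q: "\<And>x. q x \<le> m (x + y) - m y"
      by (rule sublinear_straighten[OF m(1), where y = y]) blast
    then have "q = m"
      by (intro min) (auto simp: le_fun_def)
    then show ?thesis
      using q[of x] sublinear_add[OF m(1), of x y] by simp
  qed
  have neg: "m (- x) = - m x" for x
    using add[of x "- x"] sublinear_zero[OF m(1)] by simp
  have "m (c *\<^sub>R x) = c *\<^sub>R m x" for c x
    using sublinear_scaleR[OF m(1), of c x] sublinear_scaleR[OF m(1), of "- c" x] neg[of "c *\<^sub>R x"]
    by (cases "c \<ge> 0") auto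
  then have "linear m"
    by (intro linearI add)
  with m(2) show thesis
    by (auto simp: le_fun_def intro: that)
qed

lemma scaleR_conv_scaleC: "r *\<^sub>R x = complex_of_real r *\<^sub>C x"
  by (simp add: scaleC_of_real)

lemma bounded_linear_scaleC_left: "bounded_linear (\<lambda>a. a *\<^sub>C x)"
  by (rule bounded_linear_intro[of _ "norm x"])
    (simp_all add: scaleC_add_left scaleR_conv_scaleC scaleC_scaleC norm_scaleC scaleC_complex_def)

text \<open>
  A real functional below the norm becomes a complex one with the same bound by
  \<open>L x = l x - \<i> * l (\<i> *\<^sub>C x)\<close>. To make \<open>l\<close> attain the norm at \<open>v\<close>, the norm is first
  straightened in the direction \<open>v\<close>: the result is at most \<open>- norm v\<close> at \<open>- v\<close>, and hence so is
  every linear function below it.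
\<close>

lemma complex_norming_functional:
  fixes v :: "'a::complex_normed_vector"
  obtains L :: "'a \<Rightarrow> complex" where "bounded_linear L" "\<And>c x. L (c *\<^sub>C x) = c * L x"
    "\<And>x. norm (L x) \<le> norm x" "norm (L v) = norm v"
proof -
  have "sublinear (norm :: 'a \<Rightarrow> real)"
    by (simp add: sublinear_def norm_triangle_ineq)
  then obtain q :: "'a \<Rightarrow> real" where q: "sublinear q" "\<And>x. q x \<le> norm x" "\<And>x. q x \<le> norm (x + v) - norm v"
    by (rule sublinear_straighten[where y = v]) blast
  obtain l where l: "linear l" and lq: "\<And>x. l x \<le> q x"
    by (rule linear_below_sublinear[OF q(1)]) blast
  have le: "l x \<le> norm x" for x
    using lq[of x] q(2)[of x] by linarith
  have lv: "norm v \<le> l v"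
    using lq[of "- v"] q(3)[of "- v"] linear_neg[OF l, of v] by simp
  define L where "L x = Complex (l x) (- l (\<i> *\<^sub>C x))" for x
  have add: "L (x + y) = L x + L y" for x y
    by (simp add: L_def linear_add[OF l] scaleC_add_right complex_eq_iff)
  have neg1: "\<i> *\<^sub>C \<i> *\<^sub>C x = - x" for x :: 'a
    using scaleR_conv_scaleC[of "-1" x] by (simp add: scaleC_scaleC)
  have Lr: "L (r *\<^sub>R x) = complex_of_real r * L x" for r x
  proof -
    have "\<i> *\<^sub>C (r *\<^sub>R x) = r *\<^sub>R (\<i> *\<^sub>C x)"
      by (simp add: scaleR_conv_scaleC scaleC_scaleC mult.commute)
    then show ?thesis
      by (simp add: L_def linear_cmul[OF l] complex_eq_iff)
  qed
  have Li: "L (\<i> *\<^sub>C x) = \<i> * L x" for x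
    by (simp add: L_def neg1 linear_neg[OF l] complex_eq_iff)
  have LC: "L (c *\<^sub>C x) = c * L x" for c x
  proof -
    have "c *\<^sub>C x = Re c *\<^sub>R x + Im c *\<^sub>R (\<i> *\<^sub>C x)"
      using complex_eq[of c] by (metis scaleR_conv_scaleC scaleC_add_left scaleC_scaleC mult.commute)
    then show ?thesis
      using complex_eq[of c] by (simp add: add Lr Li) (metis mult.assoc mult.commute distrib_right)
  qed
  have bound: "norm (L x) \<le> norm x" for x
  proof (cases "L x = 0")
    case False
    \<comment> \<open>Rotating \<open>x\<close> by \<open>w\<close> makes \<open>L x\<close> real and nonnegative, where its modulus is a value of \<open>l\<close>.\<close>
    define w where "w = cnj (L x) / norm (L x)"
    have "w * L x = norm (L x)"
      using False complex_norm_square[of "L x"]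
      by (simp add: w_def divide_eq_eq power2_eq_square mult.commute)
    then have "norm (L x) = Re (L (w *\<^sub>C x))"
      by (simp add: LC)
    also have "\<dots> \<le> norm (w *\<^sub>C x)"
      using le by (simp add: L_def)
    also have "\<dots> = norm x"
      using False by (simp add: norm_scaleC w_def norm_divide)
    finally show ?thesis .
  qed simp
  show thesis
  proof (rule that)
    show "bounded_linear L"
      by (rule bounded_linear_intro[of L 1]) (simp_all add: add Lr bound scaleR_conv_of_real)
    have "norm v \<le> norm (L v)"
      using lv complex_Re_le_cmod[of "L v"] by (simp add: L_def)
    then show "norm (L v) = norm v"
      using bound[of v] by simp
  qed (auto simp: LC bound)
qed

section \<open>The Schwarz lemma\<close>

text \<open>
  Restrict \<open>f\<close> to the complex line through \<open>x\<close> and compose with a functional that attains the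
  norm at \<open>f x\<close>; this leaves a holomorphic function on the unit disc that is bounded by \<open>r\<close>.
\<close>

lemma Schwarz_lemma_unit_ball:
  fixes f :: "'a::complex_normed_vector \<Rightarrow> 'b::complex_normed_vector"
  assumes hol: "holomorphic_map_on f (ball 0 1)" and zero: "f 0 = 0"
    and bound: "\<And>x. x \<in> ball 0 1 \<Longrightarrow> norm (f x) \<le> r"
    and x: "x \<in> ball 0 1"
  shows "norm (f x) \<le> r * norm x"
proof (cases "x = 0")
  case False
  define u where "u = (1 / norm x) *\<^sub>R x"
  have u: "norm u = 1"
    using False by (simp add: u_def)
  have in_ball: "z *\<^sub>C u \<in> ball 0 1" if "norm z < 1" for z
    using that u by (simp add: norm_scaleC)
  have xu: "complex_of_real (norm x) *\<^sub>C u = x"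
    using False by (simp add: u_def scaleC_of_real)
  obtain L :: "'b \<Rightarrow> complex" where L: "bounded_linear L" "\<And>c y. L (c *\<^sub>C y) = c * L y"
    and Lle: "\<And>y. norm (L y) \<le> norm y" and Lfx: "norm (L (f x)) = norm (f x)"
    by (rule complex_norming_functional[of "f x"]) blast
  have line: "((\<lambda>z. z *\<^sub>C u) has_derivative (\<lambda>z. z *\<^sub>C u)) (at z)" for z
    by (rule bounded_linear_imp_has_derivative[OF bounded_linear_scaleC_left])
  have deriv: "\<exists>d. ((\<lambda>z. L (f (z *\<^sub>C u))) has_field_derivative d) (at z)" if z: "norm z < 1" for z
  proof -
    obtain D where D: "(f has_derivative D) (at (z *\<^sub>C u))" and DC: "\<And>c v. D (c *\<^sub>C v) = c *\<^sub>C D v"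
      using hol in_ball[OF z] unfolding holomorphic_map_on_def by blast
    have "((\<lambda>z. L (f (z *\<^sub>C u))) has_derivative (\<lambda>w. L (D (w *\<^sub>C u)))) (at z)"
      by (rule bounded_linear.has_derivative[OF L(1) has_derivative_compose[OF line D]])
    moreover have "(\<lambda>w. L (D (w *\<^sub>C u))) = (*) (L (D u))"
      by (simp add: DC L(2) mult.commute fun_eq_iff)
    ultimately show ?thesis
      unfolding has_field_derivative_def by metis
  qed
  \<comment> \<open>The one-variable lemma wants values in the open disc. Dividing by a number \<open>s > r\<close> achieves
    this, also when \<open>r = 0\<close>.\<close>
  have "norm (f x) \<le> s * norm x" if s: "s > r" for s
  proof -
    have "0 \<le> r"
      using bound[of 0] zero by simp
    with s have spos: "s > 0" by simp
    let ?g = "\<lambda>z. L (f (z *\<^sub>C u)) / s"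
    have "norm (?g (norm x)) \<le> norm (complex_of_real (norm x))"
    proof (rule Schwarz_Lemma(1))
      have "?g field_differentiable at z" if "norm z < 1" for z
        using deriv[OF that] spos unfolding field_differentiable_def by (metis DERIV_cdivide)
      then show "?g holomorphic_on ball 0 1"
        by (auto simp: holomorphic_on_def intro: field_differentiable_at_within)
      have "0 *\<^sub>C u = 0"
        using scaleR_conv_scaleC[of 0 u] by simp
      then show "?g 0 = 0"
        using zero linear_0[OF bounded_linear.linear[OF L(1)]] by simp
      show "norm (?g z) < 1" if "norm z < 1" for z
        using Lle[of "f (z *\<^sub>C u)"] bound[OF in_ball[OF that]] s spos by (simp add: norm_divide)
      show "norm (complex_of_real (norm x)) < 1"
        using x by simp
    qed
    then show ?thesis
      using spos by (simp add: xu Lfx norm_divide field_simps)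
  qed
  then have "norm (f x) / norm x \<le> s" if "s > r" for s
    using that False by (simp add: field_simps)
  then have "norm (f x) / norm x \<le> r"
    by (rule dense_ge)
  then show ?thesis
    using False by (simp add: field_simps)
qed (use zero in simp)

lemma holomorphic_map_on_compose:
  assumes "holomorphic_map_on f U" "holomorphic_map_on g V" "f ` U \<subseteq> V"
  shows "holomorphic_map_on (g \<circ> f) U"
  unfolding holomorphic_map_on_def
proof
  fix x
  assume x: "x \<in> U"
  obtain D where D: "(f has_derivative D) (at x)" "\<And>c v. D (c *\<^sub>C v) = c *\<^sub>C D v"
    using assms(1) x unfolding holomorphic_map_on_def by blast
  obtain E where E: "(g has_derivative E) (at (f x))" "\<And>c v. E (c *\<^sub>C v) = c *\<^sub>C E v"
    using assms(2,3) x unfolding holomorphic_map_on_def by blast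
  have "(g \<circ> f has_derivative (\<lambda>v. E (D v))) (at x)"
    using has_derivative_compose[OF D(1) E(1)] by (simp add: o_def)
  then show "\<exists>D. (g \<circ> f has_derivative D) (at x) \<and> (\<forall>c v. D (c *\<^sub>C v) = c *\<^sub>C D v)"
    using D(2) E(2) by auto
qed

lemma holomorphic_map_on_funpow:
  assumes "holomorphic_map_on f U" "f ` U \<subseteq> U"
  shows "holomorphic_map_on (f ^^ n) U"
proof (induction n)
  case 0
  show ?case
    by (auto simp: holomorphic_map_on_def id_def intro!: has_derivative_ident)
next
  case (Suc n)
  then show ?case
    using holomorphic_map_on_compose[OF assms(1) Suc assms(2)]
    by (simp only: funpow_Suc_right)
qed

section \<open>Compactness of balls in finite dimension\<close>

text \<open>
  Induction on the spanning set. The span of \<open>B\<close> is closed since its bounded parts are compact,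
  so a vector \<open>b\<close> outside it has positive distance \<open>d\<close> from it. The coefficient of \<open>b\<close> in a vector
  of norm at most \<open>r\<close> is then bounded by \<open>r / d\<close>, and the ball in the larger span is a
  continuous image of a compact subset of a product.
\<close>

lemma compact_span_Int_cball:
  fixes B :: "'a::complex_normed_vector set"
  assumes "finite B"
  shows "compact (module.span scaleC B \<inter> cball 0 r)"
  using assms
proof (induction B arbitrary: r)
  case empty
  interpret cvs: vector_space "scaleC :: complex \<Rightarrow> 'a \<Rightarrow> 'a"
    by (rule vector_space_scaleC)
  have "cvs.span {} \<inter> cball 0 r \<subseteq> {0}"
    by simp
  then show ?case
    by (meson finite.emptyI finite.insertI finite_subset finite_imp_compact)
next
  case (insert b B)
  interpret cvs: vector_space "scaleC :: complex \<Rightarrow> 'a \<Rightarrow> 'a"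
    by (rule vector_space_scaleC)
  show ?case
  proof (cases "b \<in> cvs.span B")
    case True
    then show ?thesis
      using insert.IH cvs.span_redundant by metis
  next
    case False
    have cl: "closed (cvs.span B)"
      unfolding closed_sequential_limits
    proof (intro allI impI)
      fix y l
      assume y: "(\<forall>n. y n \<in> cvs.span B) \<and> y \<longlonglongrightarrow> l"
      then obtain s where s: "\<And>n. norm (y n) \<le> s"
        using convergent_imp_Bseq[of y] by (auto simp: convergent_def Bseq_def)
      have "closed (cvs.span B \<inter> cball 0 s)"
        using insert.IH compact_imp_closed by blast
      then show "l \<in> cvs.span B"
        using y s closed_sequentially[of "cvs.span B \<inter> cball 0 s" y l] by auto
    qed
    have "open (- cvs.span B)" "b \<in> - cvs.span B"
      using cl False by auto
    then obtain d where d: "d > 0" and "ball b d \<subseteq> - cvs.span B"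
      by (rule openE)
    then have dist: "d \<le> dist b y" if "y \<in> cvs.span B" for y
      using that by (meson ComplD linorder_not_le mem_ball subsetD)
    have coeff: "norm a * d \<le> norm (a *\<^sub>C b + y)" if y: "y \<in> cvs.span B" for a y
    proof (cases "a = 0")
      case False
      have "a *\<^sub>C b + y = a *\<^sub>C (b - (- inverse a) *\<^sub>C y)"
        using False by (simp add: scaleC_add_right scaleC_scaleC scaleC_one)
      moreover have "d \<le> norm (b - (- inverse a) *\<^sub>C y)"
        using dist[OF cvs.span_scale[OF y, of "- inverse a"]] by (simp only: dist_norm)
      ultimately show ?thesis
        by (simp add: norm_scaleC mult_left_mono)
    qed simp
    define K where "K = cball (0::complex) (r / d) \<times> (cvs.span B \<inter> cball 0 (r + r / d * norm b))"
    define F where "F = (\<lambda>(a, y). a *\<^sub>C b + y)"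
    have cont: "continuous_on S F" for S
      unfolding F_def case_prod_unfold
      by (intro continuous_intros bounded_linear.continuous_on[OF bounded_linear_scaleC_left])
    have "compact K"
      unfolding K_def by (intro compact_Times compact_cball insert.IH)
    moreover have "closed (F -` cball 0 r)"
      by (rule closed_vimage[OF closed_cball cont])
    ultimately have "compact (F ` (K \<inter> F -` cball 0 r))"
      by (intro compact_continuous_image cont compact_Int_closed)
    moreover have "F ` (K \<inter> F -` cball 0 r) = cvs.span (insert b B) \<inter> cball 0 r"
    proof (intro equalityI subsetI)
      fix x
      assume "x \<in> F ` (K \<inter> F -` cball 0 r)"
      then show "x \<in> cvs.span (insert b B) \<inter> cball 0 r"
        by (auto simp: K_def F_def cvs.span_breakdown_eq)
          (metis add_diff_cancel_left')
    next
      fix x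
      assume x: "x \<in> cvs.span (insert b B) \<inter> cball 0 r"
      then obtain a where a: "x - a *\<^sub>C b \<in> cvs.span B"
        by (auto simp: cvs.span_breakdown_eq)
      have "norm a * d \<le> r"
        using coeff[OF a, of a] x by simp
      then have na: "norm a \<le> r / d"
        using d by (simp add: field_simps)
      have "norm (x - a *\<^sub>C b) \<le> norm x + norm a * norm b"
        using norm_triangle_ineq4[of x "a *\<^sub>C b"] by (simp add: norm_scaleC)
      also have "\<dots> \<le> r + r / d * norm b"
        using x na by (intro add_mono mult_right_mono) auto
      finally have "(a, x - a *\<^sub>C b) \<in> K"
        using a na by (simp add: K_def)
      then show "x \<in> F ` (K \<inter> F -` cball 0 r)"
        using x by (intro image_eqI[of _ _ "(a, x - a *\<^sub>C b)"]) (auto simp: F_def)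
    qed
    ultimately show ?thesis
      by simp
  qed
qed

lemma compact_cball_finite_dimensional:
  assumes "\<exists>Basis. finite_dimensional_vector_space
      (scaleC :: complex \<Rightarrow> 'a \<Rightarrow> 'a::complex_normed_vector) Basis"
  shows "compact (cball (0::'a) r)"
proof -
  obtain Basis where "finite_dimensional_vector_space (scaleC :: complex \<Rightarrow> 'a \<Rightarrow> 'a) Basis"
    using assms by blast
  then interpret finite_dimensional_vector_space "scaleC :: complex \<Rightarrow> 'a \<Rightarrow> 'a" Basis .
  show ?thesis
    using compact_span_Int_cball[OF finite_Basis, of r] by (simp add: span_Basis)
qed

section \<open>Iterates of a self-map of the ball\<close>

lemma lipschitz_extension_properties:
  fixes f :: "'a::real_normed_vector \<Rightarrow> 'b::banach"
  assumes "\<exists>L. L-lipschitz_on (ball 0 1) f"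
  shows "continuous_on (cball 0 1) (lipschitz_extension f)"
    and "\<And>x. x \<in> ball 0 1 \<Longrightarrow> lipschitz_extension f x = f x"
proof -
  obtain L where "L-lipschitz_on (ball 0 1) f"
    using assms by blast
  note ext = theI'[OF lipschitz_extension_ex1[OF this], folded lipschitz_extension_def]
  show "continuous_on (cball 0 1) (lipschitz_extension f)"
    using ext lipschitz_on_continuous_on by blast
  show "lipschitz_extension f x = f x" if "x \<in> ball 0 1" for x
    using ext that by blast
qed

lemma funpow_in:
  assumes "f ` S \<subseteq> S" "x \<in> S"
  shows "(f ^^ n) x \<in> S"
  using assms by (induction n) auto

lemma continuous_on_funpow:
  assumes "continuous_on S f" "f ` S \<subseteq> S"
  shows "continuous_on S (f ^^ n)"
proof (induction n)
  case (Suc n)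
  then show ?case
    using assms funpow_in[OF assms(2)]
    by (simp only: funpow.simps)
      (intro continuous_on_compose continuous_on_subset[OF assms(1)] image_subsetI)
qed (simp add: id_def)

lemma unif_norm_le:
  assumes "\<And>x. x \<in> ball 0 1 \<Longrightarrow> norm (f x) \<le> r"
  shows "unif_norm f \<le> r"
  unfolding unif_norm_def using assms by (intro cSUP_least) auto

lemma norm_le_unif_norm:
  assumes "\<And>x. x \<in> ball 0 1 \<Longrightarrow> norm (f x) \<le> r" "x \<in> ball 0 1"
  shows "norm (f x) \<le> unif_norm f"
  unfolding unif_norm_def using assms by (intro cSUP_upper bdd_aboveI) auto

lemma unif_norm_nonneg:
  assumes "\<And>x. x \<in> ball 0 1 \<Longrightarrow> norm (f x) \<le> r"
  shows "0 \<le> unif_norm f"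
proof -
  have "norm (f 0) \<le> unif_norm f"
    by (rule norm_le_unif_norm[OF assms]) simp_all
  then show ?thesis
    by (rule order_trans[OF norm_ge_zero])
qed

text \<open>
  By the Schwarz lemma the \<open>n\<close>-th iterate contracts towards the origin with factor
  \<open>r = unif_norm (f ^^ n)\<close>, so all iterates from the index \<open>n * m\<close> on are bounded by \<open>r ^ m\<close>.
\<close>

lemma unif_norm_funpow_tendsto_zero:
  fixes f :: "'a::complex_normed_vector \<Rightarrow> 'a"
  assumes hol: "holomorphic_map_on f (ball 0 1)" and zero: "f 0 = 0"
    and self: "f ` ball 0 1 \<subseteq> ball 0 1"
    and n: "unif_norm (f ^^ n) < 1"
  shows "(\<lambda>k. unif_norm (f ^^ k)) \<longlonglongrightarrow> 0"
proof -
  define r where "r = unif_norm (f ^^ n)"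
  have in_ball: "(f ^^ k) x \<in> ball 0 1" if "x \<in> ball 0 1" for k x
    by (rule funpow_in[OF self that])
  have le1: "norm ((f ^^ k) x) \<le> 1" if "x \<in> ball 0 1" for k x
    using in_ball[OF that, of k] by simp
  have nonneg: "0 \<le> unif_norm (f ^^ k)" for k
    by (rule unif_norm_nonneg[OF le1])
  have r: "0 \<le> r" "r < 1"
    using n nonneg by (auto simp: r_def)
  have "(f ^^ n) 0 = 0"
    by (induction n) (simp_all add: zero)
  then have contr: "norm ((f ^^ n) x) \<le> r * norm x" if "x \<in> ball 0 1" for x
    using that holomorphic_map_on_funpow[OF hol self] norm_le_unif_norm[OF le1]
    unfolding r_def by (intro Schwarz_lemma_unit_ball) auto
  have pow: "norm ((f ^^ (n * m + j)) x) \<le> r ^ m" if x: "x \<in> ball 0 1" for m j x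
  proof (induction m)
    case 0
    show ?case using le1[OF x] by simp
  next
    case (Suc m)
    have "norm ((f ^^ (n * Suc m + j)) x) = norm ((f ^^ n) ((f ^^ (n * m + j)) x))"
      by (simp add: funpow_add add.assoc)
    also have "\<dots> \<le> r * norm ((f ^^ (n * m + j)) x)"
      by (rule contr[OF in_ball[OF x]])
    also have "\<dots> \<le> r ^ Suc m"
      using Suc r by (simp add: mult_left_mono)
    finally show ?case .
  qed
  show ?thesis
  proof (rule LIMSEQ_I)
    fix e :: real
    assume "e > 0"
    then obtain m where m: "r ^ m < e"
      using real_arch_pow_inv[OF _ r(2)] by blast
    have "norm (unif_norm (f ^^ k) - 0) < e" if "k \<ge> n * m" for k
    proof -
      have "unif_norm (f ^^ k) \<le> r ^ m"
        using pow[of _ m "k - n * m"] that by (intro unif_norm_le) simp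
      then show ?thesis
        using m nonneg[of k] by simp
    qed
    then show "\<exists>N. \<forall>k\<ge>N. norm (unif_norm (f ^^ k) - 0) < e"
      by blast
  qed
qed

text \<open>
  The times at which the points leave the sphere are bounded, by compactness: the set \<open>K n\<close> of
  points that have not left it after \<open>n\<close> steps decreases with \<open>n\<close>, as no point returns from
  the open ball.
\<close>

lemma funpow_norm_less_one_uniform:
  fixes g :: "'a::real_normed_vector \<Rightarrow> 'a"
  assumes comp: "compact (cball (0::'a) 1)" and cont: "continuous_on (cball 0 1) g"
    and cself: "g ` cball 0 1 \<subseteq> cball 0 1" and self: "g ` ball 0 1 \<subseteq> ball 0 1"
    and leaves: "\<And>x. x \<in> sphere 0 1 \<Longrightarrow> \<exists>n. norm ((g ^^ n) x) \<noteq> 1"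
  shows "\<exists>n\<ge>1. \<exists>s<1. \<forall>x\<in>cball 0 1. norm ((g ^^ n) x) \<le> s"
proof -
  define K where "K n = {x \<in> cball 0 1. 1 \<le> norm ((g ^^ n) x)}" for n
  have contn: "continuous_on (cball 0 1) (\<lambda>x. norm ((g ^^ n) x))" for n
    by (intro continuous_on_norm continuous_on_funpow cont cself)
  have closed: "closed (K n)" for n
    unfolding K_def by (intro continuous_on_closed_Collect_le contn continuous_on_const closed_cball)
  have decr: "K n \<subseteq> K m" if "m \<le> n" for m n
  proof
    fix x
    assume x: "x \<in> K n"
    have "(g ^^ n) x = (g ^^ (n - m)) ((g ^^ m) x)"
      using that by (metis comp_apply funpow_add le_add_diff_inverse2)
    then have "(g ^^ m) x \<notin> ball 0 1"
      using x funpow_in[OF self, of "(g ^^ m) x" "n - m"] by (auto simp: K_def)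
    then show "x \<in> K m"
      using x by (auto simp: K_def)
  qed
  have "\<exists>N. K N = {}"
  proof (rule ccontr)
    assume ne: "\<not> (\<exists>N. K N = {})"
    have "cball 0 1 \<inter> (\<Inter>n\<in>UNIV. K n) \<noteq> {}"
    proof (rule compact_imp_fip_image[OF comp closed])
      fix I :: "nat set"
      assume "finite I"
      then obtain m where "\<And>n. n \<in> I \<Longrightarrow> n \<le> m"
        unfolding finite_nat_set_iff_bounded_le by blast
      then have "K m \<subseteq> K n" if "n \<in> I" for n
        using decr that by blast
      moreover have "K m \<subseteq> cball 0 1"
        by (auto simp: K_def)
      ultimately have "K m \<subseteq> cball 0 1 \<inter> (\<Inter>n\<in>I. K n)"
        by blast
      then show "cball 0 1 \<inter> (\<Inter>n\<in>I. K n) \<noteq> {}"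
        using ne by blast
    qed
    then obtain x where x: "\<And>n. x \<in> K n"
      by blast
    have "norm ((g ^^ n) x) = 1" for n
      using x[of n] funpow_in[OF cself, of x n] by (auto simp: K_def)
    then show False
      using leaves[of x] by (metis funpow_0 mem_sphere_0)
  qed
  then obtain N where "K N = {}"
    by blast
  \<comment> \<open>The successor of \<open>N\<close> is used because the exponent has to be positive.\<close>
  then have "K (Suc N) = {}"
    using decr[of N "Suc N"] by auto
  have N: "norm ((g ^^ Suc N) x) < 1" if "x \<in> cball 0 1" for x
  proof -
    have "x \<notin> K (Suc N)"
      using \<open>K (Suc N) = {}\<close> by simp
    with that show ?thesis
      by (simp add: K_def del: funpow.simps)
  qed
  obtain y where "y \<in> cball 0 1" "\<And>x. x \<in> cball 0 1 \<Longrightarrow> norm ((g ^^ Suc N) x) \<le> norm ((g ^^ Suc N) y)"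
    using continuous_attains_sup[OF comp _ contn[of "Suc N"]] by (auto simp del: funpow.simps)
  with N show ?thesis
    by (metis le_add1 plus_1_eq_Suc)
qed

theorem proposition5p9:
  fixes \<phi> :: "'a::complex_banach \<Rightarrow> 'a"
  assumes "\<exists>Basis. finite_dimensional_vector_space (scaleC :: complex \<Rightarrow> 'a \<Rightarrow> 'a) Basis"
    and "\<phi> \<in> HL0"
    and "\<phi> ` ball 0 1 \<subseteq> ball 0 1"
  shows "((\<exists>n\<ge>1. unif_norm (\<phi> ^^ n) < 1)
            \<longleftrightarrow> (\<lambda>n. unif_norm (\<phi> ^^ n)) \<longlonglongrightarrow> 0)
       \<and> ((\<lambda>n. unif_norm (\<phi> ^^ n)) \<longlonglongrightarrow> 0
            \<longleftrightarrow> (\<forall>x\<in>cball 0 1. (\<lambda>n. norm ((lipschitz_extension \<phi> ^^ n) x)) \<longlonglongrightarrow> 0))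
       \<and> ((\<forall>x\<in>cball 0 1. (\<lambda>n. norm ((lipschitz_extension \<phi> ^^ n) x)) \<longlonglongrightarrow> 0)
            \<longleftrightarrow> (\<forall>C. C \<noteq> {} \<and> C \<subseteq> sphere 0 1 \<longrightarrow> \<not> lipschitz_extension \<phi> ` C \<subseteq> C))
       \<and> ((\<forall>C. C \<noteq> {} \<and> C \<subseteq> sphere 0 1 \<longrightarrow> \<not> lipschitz_extension \<phi> ` C \<subseteq> C)
            \<longleftrightarrow> (\<forall>x\<in>sphere 0 1. \<not> orbit_of \<phi> x \<subseteq> sphere 0 1))"
    (is "(?S1 \<longleftrightarrow> ?S2) \<and> (?S2 \<longleftrightarrow> ?S3) \<and> (?S3 \<longleftrightarrow> ?S4) \<and> (?S4 \<longleftrightarrow> ?S5)")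
proof -
  let ?\<Phi> = "lipschitz_extension \<phi>"
  have hol: "holomorphic_map_on \<phi> (ball 0 1)" and lip: "\<exists>L. L-lipschitz_on (ball 0 1) \<phi>"
    and zero: "\<phi> 0 = 0"
    using assms(2) by (auto simp: HL0_def)
  note cont = lipschitz_extension_properties(1)[OF lip]
  note ext = lipschitz_extension_properties(2)[OF lip]
  have cl: "closure (ball (0::'a) 1) = cball 0 1"
    by simp
  have self: "?\<Phi> ` ball 0 1 \<subseteq> ball 0 1"
    using assms(3) ext by auto
  have "?\<Phi> ` closure (ball 0 1) \<subseteq> cball 0 1"
    using cont self by (intro image_closure_subset) (auto simp: image_subset_iff order.strict_implies_order)
  then have cself: "?\<Phi> ` cball 0 1 \<subseteq> cball 0 1"
    by simp
  have ext_pow: "(?\<Phi> ^^ n) x = (\<phi> ^^ n) x" if "x \<in> ball 0 1" for n x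
  proof (induction n)
    case (Suc n)
    then show ?case
      using ext[OF funpow_in[OF assms(3) that]] by simp
  qed simp
  have le1: "norm ((\<phi> ^^ n) x) \<le> 1" if "x \<in> ball 0 1" for n x
    using funpow_in[OF assms(3) that, of n] by simp
  have 12: ?S2 if ?S1
    using that unif_norm_funpow_tendsto_zero[OF hol zero assms(3)] by blast
  have 23: ?S3 if ?S2
  proof
    fix x :: 'a
    assume x: "x \<in> cball 0 1"
    have "norm ((?\<Phi> ^^ n) x) \<le> unif_norm (\<phi> ^^ n)" for n
    proof (rule continuous_le_on_closure[of "ball 0 1" "\<lambda>x. norm ((?\<Phi> ^^ n) x)" x])
      show "continuous_on (closure (ball 0 1)) (\<lambda>x. norm ((?\<Phi> ^^ n) x))"
        unfolding cl by (intro continuous_on_norm continuous_on_funpow cont cself)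
      show "x \<in> closure (ball 0 1)"
        unfolding cl by (rule x)
      show "norm ((?\<Phi> ^^ n) y) \<le> unif_norm (\<phi> ^^ n)" if "y \<in> ball 0 1" for y
        unfolding ext_pow[OF that] by (rule norm_le_unif_norm[OF le1 that])
    qed
    then show "(\<lambda>n. norm ((?\<Phi> ^^ n) x)) \<longlonglongrightarrow> 0"
      by (intro tendsto_sandwich[OF _ _ tendsto_const that]) auto
  qed
  have 34: ?S4 if S3: ?S3
  proof (intro allI impI notI)
    fix C :: "'a set"
    assume C: "C \<noteq> {} \<and> C \<subseteq> sphere 0 1" and inv: "?\<Phi> ` C \<subseteq> C"
    then obtain x where x: "x \<in> C" by blast
    have "norm ((?\<Phi> ^^ n) x) = 1" for n
      using funpow_in[OF inv x, of n] C by auto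
    moreover have "(\<lambda>n. norm ((?\<Phi> ^^ n) x)) \<longlonglongrightarrow> 0"
      using S3 x C by force
    ultimately show False
      by (simp add: LIMSEQ_const_iff)
  qed
  have orbit: "orbit_of \<phi> x = range (\<lambda>n. (?\<Phi> ^^ n) x)" for x
  proof -
    have "\<exists>n. n \<ge> 1 \<and> (?\<Phi> ^^ m) x = (?\<Phi> ^^ n) x" if "(?\<Phi> ^^ m) x \<noteq> x" for m
      using that by (intro exI[of _ m]) (cases m, auto)
    then show ?thesis
      unfolding orbit_of_def by (auto intro: range_eqI[of _ _ 0])
  qed
  have 45: ?S5 if S4: ?S4
  proof (intro ballI notI)
    fix x :: 'a
    assume "orbit_of \<phi> x \<subseteq> sphere 0 1"
    moreover have "orbit_of \<phi> x \<noteq> {}"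
      by (simp add: orbit_of_def)
    moreover have "?\<Phi> ` orbit_of \<phi> x \<subseteq> orbit_of \<phi> x"
      unfolding orbit by (auto intro: range_eqI[of _ _ "Suc _"])
    ultimately show False
      using S4[rule_format, of "orbit_of \<phi> x"] by blast
  qed
  have 51: ?S1 if S5: ?S5
  proof -
    have "\<exists>n. norm ((?\<Phi> ^^ n) x) \<noteq> 1" if "x \<in> sphere 0 1" for x
      using S5[rule_format, OF that] unfolding orbit by auto
    then obtain n s where n: "n \<ge> 1" "s < 1" and s: "\<And>x. x \<in> cball 0 1 \<Longrightarrow> norm ((?\<Phi> ^^ n) x) \<le> s"
      using funpow_norm_less_one_uniform[OF compact_cball_finite_dimensional[OF assms(1)] cont cself self]
      by blast
    have "unif_norm (\<phi> ^^ n) \<le> s"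
      using s ext_pow by (intro unif_norm_le) (metis ball_subset_cball subsetD)
    with n show ?thesis
      by (intro exI[of _ n]) auto
  qed
  show ?thesis
    using 12 23 34 45 51 by blast
qed

end
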